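(* Assume that $\mathcal{D}$ is a semi-Ramsey ultrafilter on $\bigcup_{i<\omega}\{i\}\times(i+1)$. Suppose that $\mathbb{P}$ is a proper $\omega^\omega$-bounding forcing notion such that $\Vdash_{\mathbb{P}}$ "$\mathcal{D}$ generates an ultrafilter". Then $\Vdash_{\mathbb{P}}$ "$\mathcal{D}$ generates a semi-Ramsey ultrafilter".
   Context: Let $I=\bigcup_{i<\omega}\{i\}\times(i+1)$. For a filter $\mathcal{D}$ on $I$, the game $G^{sR}(\mathcal{D})$: at move $n$, Player I plays $A_n\in\mathcal{D}$ and Player II answers with $i_n\in\omega$ and $a_n\in[A_n\cap(\{i_n\}\times(i_n+1))]^{\le n}$; Player I wins iff $\bigcup_n a_n\notin\mathcal{D}$. $\mathcal{D}$ is semi-Ramsey if Player I has no winning strategy in $G^{sR}(\mathcal{D})$. "$\mathcal{D}$ generates an ultrafilter" in the extension means the filter generated by the ground model $\mathcal{D}$ is an ultrafilter there. $\omega^\omega$-bounding: every real in $\omega^\omega$ of the extension is eventually dominated by a ground model real. *)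

theory Defs
  imports "HOL-Library.Countable_Set" "HOL-Library.FSet"
begin

definition filter_on :: "'a set \<Rightarrow> 'a set set \<Rightarrow> bool" where
  "filter_on X F \<longleftrightarrow>
     F \<subseteq> Pow X \<and> X \<in> F \<and> {} \<notin> F \<and>
     (\<forall>A\<in>F. \<forall>B\<in>F. A \<inter> B \<in> F) \<and>
     (\<forall>A\<in>F. \<forall>B. A \<subseteq> B \<and> B \<subseteq> X \<longrightarrow> B \<in> F)"

definition ultrafilter_on :: "'a set \<Rightarrow> 'a set set \<Rightarrow> bool" where
  "ultrafilter_on X F \<longleftrightarrow> filter_on X F \<and> (\<forall>A\<subseteq>X. A \<in> F \<or> X - A \<in> F)"

definition triangular_set :: "(nat \<times> nat) set" where
  "triangular_set = (\<Union>i. {i} \<times> {..<i + 1})"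

text \<open>
  An answer \<open>(i, a)\<close> of Player II.  As \<open>a\<close> is a finite set of pairs of natural numbers, the answers
  and the finite sequences of answers form countable sets that are the same in the ground model and
  in every generic extension.
\<close>
type_synonym answer = "nat \<times> (nat \<times> nat) fset"

definition legal_answer :: "nat \<Rightarrow> (nat \<times> nat) set \<Rightarrow> answer \<Rightarrow> bool" where
  "legal_answer n A m \<longleftrightarrow>
     fset (snd m) \<subseteq> A \<inter> ({fst m} \<times> {..<fst m + 1}) \<and> fcard (snd m) \<le> n"

text \<open>
  A strategy of Player I maps the sequence of the previous answers of Player II to the next move of
  Player I.  It is required to return an element of \<open>D\<close> also on sequences that do not arise in a
  play; this is harmless, since values there can be changed to any element of \<open>D\<close>.
\<close>
definition strategy_I :: "(nat \<times> nat) set set \<Rightarrow> (answer list \<Rightarrow> (nat \<times> nat) set) \<Rightarrow> bool" where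
  "strategy_I D \<sigma> \<longleftrightarrow> (\<forall>s. \<sigma> s \<in> D)"

definition play_against :: "(answer list \<Rightarrow> (nat \<times> nat) set) \<Rightarrow> (nat \<Rightarrow> answer) \<Rightarrow> bool" where
  "play_against \<sigma> g \<longleftrightarrow> (\<forall>n. legal_answer n (\<sigma> (map g [0..<n])) (g n))"

definition winning_strategy_I ::
    "(nat \<times> nat) set set \<Rightarrow> (answer list \<Rightarrow> (nat \<times> nat) set) \<Rightarrow> bool" where
  "winning_strategy_I D \<sigma> \<longleftrightarrow>
     strategy_I D \<sigma> \<and> (\<forall>g. play_against \<sigma> g \<longrightarrow> (\<Union>n. fset (snd (g n))) \<notin> D)"

definition semi_Ramsey :: "(nat \<times> nat) set set \<Rightarrow> bool" where
  "semi_Ramsey D \<longleftrightarrow> \<not> (\<exists>\<sigma>. winning_strategy_I D \<sigma>)"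

definition ctbl_subsets :: "'u set \<Rightarrow> 'u set set" where
  "ctbl_subsets A = {X. X \<subseteq> A \<and> countable X}"

definition club :: "'u set \<Rightarrow> 'u set set \<Rightarrow> bool" where
  "club A C \<longleftrightarrow>
     C \<subseteq> ctbl_subsets A \<and>
     (\<forall>X\<in>ctbl_subsets A. \<exists>Y\<in>C. X \<subseteq> Y) \<and>
     (\<forall>g :: nat \<Rightarrow> 'u set. (\<forall>n. g n \<in> C \<and> g n \<subseteq> g (Suc n)) \<longrightarrow> (\<Union>n. g n) \<in> C)"

definition stationary :: "'u set \<Rightarrow> 'u set set \<Rightarrow> bool" where
  "stationary A S \<longleftrightarrow> S \<subseteq> ctbl_subsets A \<and> (\<forall>C. club A C \<longrightarrow> S \<inter> C \<noteq> {})"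

text \<open>
  A sentence of the forcing language is represented by the predicate \<open>\<lambda>p. p \<tturnstile> \<phi>\<close> on conditions.
  A ground model set is represented by a HOL set; a set \<open>x\<close> of the extension with \<open>x \<subseteq> V\<close> has a name
  consisting of pairs \<open>(a, s)\<close>, meaning that \<open>a\<close> is put into the set if \<open>s\<close> is in the generic filter.
  Every subset of a ground model set that lies in the extension has such a name, so quantifying over
  these names is quantifying over all subsets in the extension.  Names for sets of such subsets are
  iterated names.
\<close>
type_synonym 'p sentence = "'p \<Rightarrow> bool"
type_synonym ('a, 'p) name = "('a \<times> 'p) set"

locale forcing_notion =
  fixes P :: "'p set" and leq :: "'p rel"   \<comment> \<open>\<open>(q, p) \<in> leq\<close>: the condition \<open>q\<close> is stronger than \<open>p\<close>\<close>
  assumes preorder: "preorder_on P leq" and nonempty: "P \<noteq> {}"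
begin

text \<open>
  The usual recursive clauses for negation, conjunction and universal quantification; the other
  connectives are classical abbreviations.
\<close>

definition fNot :: "'p sentence \<Rightarrow> 'p sentence"  ("\<^bold>\<not> _" [40] 40) where
  "(\<^bold>\<not> \<phi>) = (\<lambda>p. \<forall>q. (q, p) \<in> leq \<longrightarrow> \<not> \<phi> q)"

definition fAnd :: "'p sentence \<Rightarrow> 'p sentence \<Rightarrow> 'p sentence"  (infixr "\<^bold>\<and>" 35) where
  "(\<phi> \<^bold>\<and> \<psi>) = (\<lambda>p. \<phi> p \<and> \<psi> p)"

definition fAll :: "('x \<Rightarrow> 'p sentence) \<Rightarrow> 'p sentence"  (binder "\<^bold>\<forall>" 10) where
  "(\<^bold>\<forall>x. \<Phi> x) = (\<lambda>p. \<forall>x. \<Phi> x p)"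

definition fOr :: "'p sentence \<Rightarrow> 'p sentence \<Rightarrow> 'p sentence"  (infixr "\<^bold>\<or>" 30) where
  "(\<phi> \<^bold>\<or> \<psi>) = (\<^bold>\<not> (\<^bold>\<not> \<phi> \<^bold>\<and> \<^bold>\<not> \<psi>))"

definition fImp :: "'p sentence \<Rightarrow> 'p sentence \<Rightarrow> 'p sentence"  (infixr "\<^bold>\<longrightarrow>" 25) where
  "(\<phi> \<^bold>\<longrightarrow> \<psi>) = (\<^bold>\<not> (\<phi> \<^bold>\<and> \<^bold>\<not> \<psi>))"

definition fIff :: "'p sentence \<Rightarrow> 'p sentence \<Rightarrow> 'p sentence"  (infixr "\<^bold>\<longleftrightarrow>" 25) where
  "(\<phi> \<^bold>\<longleftrightarrow> \<psi>) = ((\<phi> \<^bold>\<longrightarrow> \<psi>) \<^bold>\<and> (\<psi> \<^bold>\<longrightarrow> \<phi>))"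

definition fEx :: "('x \<Rightarrow> 'p sentence) \<Rightarrow> 'p sentence"  (binder "\<^bold>\<exists>" 10) where
  "(\<^bold>\<exists>x. \<Phi> x) = (\<^bold>\<not> (\<^bold>\<forall>x. \<^bold>\<not> \<Phi> x))"

text \<open>An absolute statement about ground model objects.\<close>
definition ground :: "bool \<Rightarrow> 'p sentence" where
  "ground b = (\<lambda>p. b)"

definition forced :: "'p sentence \<Rightarrow> bool" where
  "forced \<phi> \<longleftrightarrow> (\<forall>p\<in>P. \<phi> p)"

definition mem :: "'a \<Rightarrow> ('a, 'p) name \<Rightarrow> 'p sentence"  (infix "\<^bold>\<in>" 50) where
  "(a \<^bold>\<in> \<tau>) = (\<lambda>p. \<forall>q. (q, p) \<in> leq \<longrightarrow> (\<exists>r s. (r, q) \<in> leq \<and> (a, s) \<in> \<tau> \<and> (r, s) \<in> leq))"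

definition sub :: "('a, 'p) name \<Rightarrow> ('a, 'p) name \<Rightarrow> 'p sentence"  (infix "\<^bold>\<subseteq>" 50) where
  "(\<tau> \<^bold>\<subseteq> \<upsilon>) = (\<^bold>\<forall>a. a \<^bold>\<in> \<tau> \<^bold>\<longrightarrow> a \<^bold>\<in> \<upsilon>)"

definition set_eq :: "('a, 'p) name \<Rightarrow> ('a, 'p) name \<Rightarrow> 'p sentence"  (infix "\<^bold>=" 50) where
  "(\<tau> \<^bold>= \<upsilon>) = (\<^bold>\<forall>a. a \<^bold>\<in> \<tau> \<^bold>\<longleftrightarrow> a \<^bold>\<in> \<upsilon>)"

definition check :: "'a set \<Rightarrow> ('a, 'p) name" where
  "check X = X \<times> P"

definition mem2 :: "('a, 'p) name \<Rightarrow> (('a, 'p) name, 'p) name \<Rightarrow> 'p sentence"  (infix "\<^bold>\<in>\<^sub>2" 50) where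
  "(\<tau> \<^bold>\<in>\<^sub>2 C) = (\<lambda>p. \<forall>q. (q, p) \<in> leq \<longrightarrow>
      (\<exists>r s \<upsilon>. (r, q) \<in> leq \<and> (\<upsilon>, s) \<in> C \<and> (r, s) \<in> leq \<and> (\<tau> \<^bold>= \<upsilon>) r))"

text \<open>A relation all of whose members are ground model pairs is a total function.\<close>
definition fun_name :: "('a \<times> 'b, 'p) name \<Rightarrow> 'p sentence" where
  "fun_name f =
     ((\<^bold>\<forall>a. \<^bold>\<exists>b. (a, b) \<^bold>\<in> f) \<^bold>\<and>
      (\<^bold>\<forall>a b c. (a, b) \<^bold>\<in> f \<^bold>\<and> (a, c) \<^bold>\<in> f \<^bold>\<longrightarrow> ground (b = c)))"

text \<open>
  A family of sets \<open>a \<mapsto> R(a)\<close> of the extension is coded by the relation \<open>{(a, b). b \<in> R(a)}\<close>;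
  \<open>section_name R a\<close> names \<open>R(a)\<close>.
\<close>
definition section_name :: "('a \<times> 'b, 'p) name \<Rightarrow> 'a \<Rightarrow> ('b, 'p) name" where
  "section_name R a = {(b, p). ((a, b), p) \<in> R}"

text \<open>\<open>U = (\<Union>a. R(a))\<close>\<close>
definition is_Union :: "('b, 'p) name \<Rightarrow> ('a \<times> 'b, 'p) name \<Rightarrow> 'p sentence" where
  "is_Union U R = (\<^bold>\<forall>b. b \<^bold>\<in> U \<^bold>\<longleftrightarrow> (\<^bold>\<exists>a. (a, b) \<^bold>\<in> R))"

definition omega_omega_bounding :: bool where
  "omega_omega_bounding \<longleftrightarrow> forced
     (\<^bold>\<forall>f :: (nat \<times> nat, 'p) name. fun_name f \<^bold>\<longrightarrow>
        (\<^bold>\<exists>h :: nat \<Rightarrow> nat. \<^bold>\<exists>m. \<^bold>\<forall>n k. ground (m \<le> n) \<^bold>\<and> (n, k) \<^bold>\<in> f \<^bold>\<longrightarrow> ground (k \<le> h n)))"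

text \<open>
  In the extension, \<open>\<tau>\<close> is a countable subset of \<open>A\<close>: it is covered by the range of a function from the
  natural numbers into the (nonempty) type of the elements of \<open>A\<close>.
\<close>
definition in_ctbl_subsets :: "('u, 'p) name \<Rightarrow> 'u set \<Rightarrow> 'p sentence" where
  "in_ctbl_subsets \<tau> A =
     (\<tau> \<^bold>\<subseteq> check A \<^bold>\<and>
      (\<^bold>\<exists>f :: (nat \<times> 'u, 'p) name. fun_name f \<^bold>\<and> (\<^bold>\<forall>x. x \<^bold>\<in> \<tau> \<^bold>\<longrightarrow> (\<^bold>\<exists>n. (n, x) \<^bold>\<in> f))))"

definition club_name :: "'u set \<Rightarrow> (('u, 'p) name, 'p) name \<Rightarrow> 'p sentence" where
  "club_name A C =
     ((\<^bold>\<forall>\<tau>. \<tau> \<^bold>\<in>\<^sub>2 C \<^bold>\<longrightarrow> in_ctbl_subsets \<tau> A) \<^bold>\<and>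
      (\<^bold>\<forall>\<tau>. in_ctbl_subsets \<tau> A \<^bold>\<longrightarrow> (\<^bold>\<exists>\<upsilon>. \<upsilon> \<^bold>\<in>\<^sub>2 C \<^bold>\<and> \<tau> \<^bold>\<subseteq> \<upsilon>)) \<^bold>\<and>
      (\<^bold>\<forall>g :: (nat \<times> 'u, 'p) name.
         (\<^bold>\<forall>n. section_name g n \<^bold>\<in>\<^sub>2 C \<^bold>\<and> section_name g n \<^bold>\<subseteq> section_name g (Suc n)) \<^bold>\<longrightarrow>
         (\<^bold>\<forall>U. is_Union U g \<^bold>\<longrightarrow> U \<^bold>\<in>\<^sub>2 C)))"

definition remains_stationary :: "'u set \<Rightarrow> 'u set set \<Rightarrow> 'p sentence" where
  "remains_stationary A S =
     (\<^bold>\<forall>C. club_name A C \<^bold>\<longrightarrow> (\<^bold>\<exists>X. ground (X \<in> S) \<^bold>\<and> check X \<^bold>\<in>\<^sub>2 C))"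

definition preserves_stationary :: "'u set \<Rightarrow> bool" where
  "preserves_stationary A \<longleftrightarrow> (\<forall>S. stationary A S \<longrightarrow> forced (remains_stationary A S))"

text \<open>
  Shelah's definition: for every uncountable \<open>A\<close>, stationary sets of countable subsets of \<open>A\<close> remain
  stationary.  HOL cannot quantify over the type of the elements of \<open>A\<close> inside a formula.  Here \<open>A\<close>
  ranges over the uncountable subsets of a type of cardinality \<open>2^(2^\<kappa>)\<close>, where \<open>\<kappa>\<close> is the maximum
  of \<open>\<aleph>\<^sub>0\<close> and the cardinality of the type of conditions, so all \<open>\<lambda> \<le> 2^(2^\<kappa>)\<close> are covered.  By the
  standard argument with countable elementary submodels of \<open>H((2^\<kappa>)\<^sup>+)\<close>, whose cardinality is at most
  \<open>2^(2^\<kappa>)\<close>, this implies the preservation for all larger \<open>\<lambda>\<close>.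
\<close>
definition proper :: bool where
  "proper \<longleftrightarrow> (\<forall>A :: ('p + nat) set set set. uncountable A \<longrightarrow> preserves_stationary A)"

text \<open>
  A family \<open>F\<close> of subsets of \<open>X\<close> in the extension is given by the sentences \<open>F \<tau>\<close> expressing that
  (the set named by) \<open>\<tau>\<close> belongs to \<open>F\<close>.
\<close>

text \<open>The filter on \<open>X\<close> generated by a ground model filter \<open>D\<close>.\<close>
definition gen_filter :: "'a set \<Rightarrow> 'a set set \<Rightarrow> ('a, 'p) name \<Rightarrow> 'p sentence" where
  "gen_filter X D \<tau> = (\<tau> \<^bold>\<subseteq> check X \<^bold>\<and> (\<^bold>\<exists>B. ground (B \<in> D) \<^bold>\<and> check B \<^bold>\<subseteq> \<tau>))"

definition f_filter_on :: "'a set \<Rightarrow> (('a, 'p) name \<Rightarrow> 'p sentence) \<Rightarrow> 'p sentence" where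
  "f_filter_on X F =
     ((\<^bold>\<forall>A. F A \<^bold>\<longrightarrow> A \<^bold>\<subseteq> check X) \<^bold>\<and>
      F (check X) \<^bold>\<and> \<^bold>\<not> F (check {}) \<^bold>\<and>
      (\<^bold>\<forall>A B. F A \<^bold>\<and> F B \<^bold>\<longrightarrow>
         (\<^bold>\<forall>C. (\<^bold>\<forall>x. x \<^bold>\<in> C \<^bold>\<longleftrightarrow> x \<^bold>\<in> A \<^bold>\<and> x \<^bold>\<in> B) \<^bold>\<longrightarrow> F C)) \<^bold>\<and>
      (\<^bold>\<forall>A B. F A \<^bold>\<and> A \<^bold>\<subseteq> B \<^bold>\<and> B \<^bold>\<subseteq> check X \<^bold>\<longrightarrow> F B))"

definition f_ultrafilter_on :: "'a set \<Rightarrow> (('a, 'p) name \<Rightarrow> 'p sentence) \<Rightarrow> 'p sentence" where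
  "f_ultrafilter_on X F =
     (f_filter_on X F \<^bold>\<and>
      (\<^bold>\<forall>A. A \<^bold>\<subseteq> check X \<^bold>\<longrightarrow>
         F A \<^bold>\<or> (\<^bold>\<forall>B. (\<^bold>\<forall>x. x \<^bold>\<in> B \<^bold>\<longleftrightarrow> ground (x \<in> X) \<^bold>\<and> \<^bold>\<not> x \<^bold>\<in> A) \<^bold>\<longrightarrow> F B)))"

definition f_legal_answer :: "nat \<Rightarrow> (nat \<times> nat, 'p) name \<Rightarrow> answer \<Rightarrow> 'p sentence" where
  "f_legal_answer n A m =
     (check (fset (snd m)) \<^bold>\<subseteq> A \<^bold>\<and>
      ground (fset (snd m) \<subseteq> {fst m} \<times> {..<fst m + 1}) \<^bold>\<and>
      ground (fcard (snd m) \<le> n))"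

text \<open>A strategy is named by the relation coding the family \<open>s \<mapsto> \<sigma>(s)\<close>.\<close>
definition f_strategy_I ::
    "((nat \<times> nat, 'p) name \<Rightarrow> 'p sentence) \<Rightarrow> (answer list \<times> (nat \<times> nat), 'p) name \<Rightarrow> 'p sentence" where
  "f_strategy_I F \<sigma> = (\<^bold>\<forall>s. F (section_name \<sigma> s))"

text \<open>\<open>s\<close> is the finite sequence of the first \<open>n\<close> values of the function \<open>g\<close>.\<close>
definition f_restrict :: "(nat \<times> answer, 'p) name \<Rightarrow> nat \<Rightarrow> answer list \<Rightarrow> 'p sentence" where
  "f_restrict g n s =
     (ground (length s = n) \<^bold>\<and> (\<^bold>\<forall>k. ground (k < n) \<^bold>\<longrightarrow> (k, s ! k) \<^bold>\<in> g))"

definition f_play_against ::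
    "(answer list \<times> (nat \<times> nat), 'p) name \<Rightarrow> (nat \<times> answer, 'p) name \<Rightarrow> 'p sentence" where
  "f_play_against \<sigma> g =
     (fun_name g \<^bold>\<and>
      (\<^bold>\<forall>n s m. f_restrict g n s \<^bold>\<and> (n, m) \<^bold>\<in> g \<^bold>\<longrightarrow> f_legal_answer n (section_name \<sigma> s) m))"

definition f_winning_strategy_I ::
    "((nat \<times> nat, 'p) name \<Rightarrow> 'p sentence) \<Rightarrow> (answer list \<times> (nat \<times> nat), 'p) name \<Rightarrow> 'p sentence" where
  "f_winning_strategy_I F \<sigma> =
     (f_strategy_I F \<sigma> \<^bold>\<and>
      (\<^bold>\<forall>g. f_play_against \<sigma> g \<^bold>\<longrightarrow>
         (\<^bold>\<forall>U. (\<^bold>\<forall>x. x \<^bold>\<in> U \<^bold>\<longleftrightarrow> (\<^bold>\<exists>n m. (n, m) \<^bold>\<in> g \<^bold>\<and> ground (x |\<in>| snd m))) \<^bold>\<longrightarrow> \<^bold>\<not> F U)))"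

definition f_semi_Ramsey :: "((nat \<times> nat, 'p) name \<Rightarrow> 'p sentence) \<Rightarrow> 'p sentence" where
  "f_semi_Ramsey F = (\<^bold>\<not> (\<^bold>\<exists>\<sigma>. f_winning_strategy_I F \<sigma>))"

definition forces_generates_ultrafilter :: "(nat \<times> nat) set set \<Rightarrow> bool" where
  "forces_generates_ultrafilter D \<longleftrightarrow>
     forced (f_ultrafilter_on triangular_set (gen_filter triangular_set D))"

definition forces_generates_semi_Ramsey_ultrafilter :: "(nat \<times> nat) set set \<Rightarrow> bool" where
  "forces_generates_semi_Ramsey_ultrafilter D \<longleftrightarrow>
     forced (f_ultrafilter_on triangular_set (gen_filter triangular_set D) \<^bold>\<and>
             f_semi_Ramsey (gen_filter triangular_set D))"

end

end

(*
  Let \<sigma> be forced to be a winning strategy of Player I.  Choose B_s in D below \<sigma>(s) in the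
  extension.  By properness the countable set of all B_s is covered by a countable ground model
  set {E_k : k < \<omega>}, and by \<omega>^\<omega>-bounding the index of B_s is at most h(s) for a ground model
  function h.  Hence \<rho>(s) = E_0 \<inter> ... \<inter> E_h(s) (leaving out the E_k that are not in D) is a ground model
  strategy contained in \<sigma> everywhere, so a ground model play that beats \<rho> also beats \<sigma>.
*)

theory Submission
  imports Defs
begin

text \<open>Covering alone would be too weak: \<open>D\<close> is closed only under finite
  intersections, so a countable list of candidates for the move at \<open>s\<close> gives no member
  of \<open>D\<close> below that move. Bounding cuts the candidates at each \<open>s\<close> down to
  finitely many. Since the ground model strategy must lie below the named one at every
  \<open>s\<close>, the bound has to hold from 0 on and not just eventually. Both hypotheses act on
  the same function of the extension. Properness supplies a ground model numbering of its values,
  and only this numbering turns a function with sets as values into one from naturals to naturals,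
  to which bounding applies. Smaller moves of Player I only restrict Player II, and finite sequences
  of answers are the same in both models, so the two strategies can be compared argument by
  argument. No generic filter is available: everything is argued with the forcing relation, where an
  existential statement is witnessed only after strengthening the condition. Hence the role of
  regular sentences and of a choice principle for names.\<close>

context forcing_notion
begin

section \<open>Regular sentences and the clauses of the forcing relation\<close>

definition below :: "'p \<Rightarrow> 'p \<Rightarrow> bool" (infix "\<preceq>" 50) where
  "q \<preceq> p \<longleftrightarrow> (q, p) \<in> leq"

lemma below_in: "q \<preceq> p \<Longrightarrow> q \<in> P" "q \<preceq> p \<Longrightarrow> p \<in> P"
  using preorder by (auto simp: below_def preorder_on_def)

lemma below_refl [simp]: "p \<in> P \<Longrightarrow> p \<preceq> p"
  using preorder by (auto simp: below_def preorder_on_def refl_on_def)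

lemma below_self: "q \<preceq> p \<Longrightarrow> q \<preceq> q"
  by (rule below_refl[OF below_in(1)])

lemma below_trans: "r \<preceq> q \<Longrightarrow> q \<preceq> p \<Longrightarrow> r \<preceq> p"
  using preorder by (auto simp: below_def preorder_on_def dest: transD)

text \<open>On \<open>P\<close> these are the regular open sets of the forcing order, that is, the
  values of sentences in the Boolean completion. A sentence may be any predicate on conditions;
  outside this class monotonicity and the familiar clause for implication can fail.\<close>

definition regular :: "'p sentence \<Rightarrow> bool" where
  "regular \<phi> \<longleftrightarrow> (\<forall>p\<in>P. \<phi> p \<longleftrightarrow> (\<forall>q. q \<preceq> p \<longrightarrow> (\<exists>r. r \<preceq> q \<and> \<phi> r)))"

lemma regular_mono: "regular \<phi> \<Longrightarrow> \<phi> p \<Longrightarrow> q \<preceq> p \<Longrightarrow> \<phi> q"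
  unfolding regular_def by (meson below_in below_trans)

lemma regular_dense:
  "regular \<phi> \<Longrightarrow> p \<in> P \<Longrightarrow> (\<And>q. q \<preceq> p \<Longrightarrow> \<exists>r. r \<preceq> q \<and> \<phi> r) \<Longrightarrow> \<phi> p"
  unfolding regular_def by blast

lemma regularI:
  assumes "\<And>p q. \<phi> p \<Longrightarrow> q \<preceq> p \<Longrightarrow> \<phi> q"
    and "\<And>p. p \<in> P \<Longrightarrow> (\<And>q. q \<preceq> p \<Longrightarrow> \<exists>r. r \<preceq> q \<and> \<phi> r) \<Longrightarrow> \<phi> p"
  shows "regular \<phi>"
  unfolding regular_def by (meson assms below_in below_refl)

lemma force_Not: "(\<^bold>\<not> \<phi>) p \<longleftrightarrow> (\<forall>q. q \<preceq> p \<longrightarrow> \<not> \<phi> q)"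
  by (simp add: fNot_def below_def)

lemma force_And: "(\<phi> \<^bold>\<and> \<psi>) p \<longleftrightarrow> \<phi> p \<and> \<psi> p"
  by (simp add: fAnd_def)

lemma force_All: "(\<^bold>\<forall>x. \<Phi> x) p \<longleftrightarrow> (\<forall>x. \<Phi> x p)"
  by (simp add: fAll_def)

lemma force_ground: "ground b p \<longleftrightarrow> b"
  by (simp add: ground_def)

lemma regular_Not [simp]:
  assumes "regular \<phi>"
  shows "regular (\<^bold>\<not> \<phi>)"
proof (rule regularI)
  show "(\<^bold>\<not> \<phi>) q" if "(\<^bold>\<not> \<phi>) p" "q \<preceq> p" for p q
    using that by (auto simp: force_Not intro: below_trans)
  show "(\<^bold>\<not> \<phi>) p" if "\<And>q. q \<preceq> p \<Longrightarrow> \<exists>r. r \<preceq> q \<and> (\<^bold>\<not> \<phi>) r" for p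
    unfolding force_Not
  proof (intro allI impI notI)
    fix q assume "q \<preceq> p" "\<phi> q"
    with that obtain r where "r \<preceq> q" "(\<^bold>\<not> \<phi>) r" by blast
    moreover have "\<phi> r"
      using assms \<open>\<phi> q\<close> \<open>r \<preceq> q\<close> by (rule regular_mono)
    ultimately show False
      by (auto simp: force_Not below_in)
  qed
qed

lemma regular_And [simp]:
  assumes "regular \<phi>" and "regular \<psi>"
  shows "regular (\<phi> \<^bold>\<and> \<psi>)"
proof (rule regularI)
  show "(\<phi> \<^bold>\<and> \<psi>) q" if "(\<phi> \<^bold>\<and> \<psi>) p" "q \<preceq> p" for p q
    using assms that unfolding force_And by (blast intro: regular_mono)
  show "(\<phi> \<^bold>\<and> \<psi>) p" if "p \<in> P" and "\<And>q. q \<preceq> p \<Longrightarrow> \<exists>r. r \<preceq> q \<and> (\<phi> \<^bold>\<and> \<psi>) r" for p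
    using assms that unfolding force_And by (blast intro: regular_dense)
qed

lemma regular_All [simp]:
  assumes "\<And>x. regular (\<Phi> x)"
  shows "regular (\<^bold>\<forall>x. \<Phi> x)"
proof (rule regularI)
  show "(\<^bold>\<forall>x. \<Phi> x) q" if "(\<^bold>\<forall>x. \<Phi> x) p" "q \<preceq> p" for p q
    using assms that unfolding force_All by (blast intro: regular_mono)
  show "(\<^bold>\<forall>x. \<Phi> x) p" if "p \<in> P" and "\<And>q. q \<preceq> p \<Longrightarrow> \<exists>r. r \<preceq> q \<and> (\<^bold>\<forall>x. \<Phi> x) r" for p
    using assms that unfolding force_All by (blast intro: regular_dense)
qed

lemma regular_ground [simp]: "regular (ground b)"
  by (rule regularI) (auto simp: force_ground dest: below_refl)

lemma regular_Or [simp]: "regular \<phi> \<Longrightarrow> regular \<psi> \<Longrightarrow> regular (\<phi> \<^bold>\<or> \<psi>)"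
  by (simp add: fOr_def)

lemma regular_Imp [simp]: "regular \<phi> \<Longrightarrow> regular \<psi> \<Longrightarrow> regular (\<phi> \<^bold>\<longrightarrow> \<psi>)"
  by (simp add: fImp_def)

lemma regular_Iff [simp]: "regular \<phi> \<Longrightarrow> regular \<psi> \<Longrightarrow> regular (\<phi> \<^bold>\<longleftrightarrow> \<psi>)"
  by (simp add: fIff_def)

lemma regular_Ex [simp]: "(\<And>x. regular (\<Phi> x)) \<Longrightarrow> regular (\<^bold>\<exists>x. \<Phi> x)"
  by (simp add: fEx_def)

lemma force_Imp:
  assumes "regular \<phi>" and "regular \<psi>"
  shows "(\<phi> \<^bold>\<longrightarrow> \<psi>) p \<longleftrightarrow> (\<forall>q. q \<preceq> p \<longrightarrow> \<phi> q \<longrightarrow> \<psi> q)"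
proof -
  have "(\<phi> \<^bold>\<longrightarrow> \<psi>) p \<longleftrightarrow> (\<forall>q. q \<preceq> p \<longrightarrow> \<phi> q \<longrightarrow> (\<exists>r. r \<preceq> q \<and> \<psi> r))"
    by (auto simp: fImp_def force_Not force_And)
  also have "\<dots> \<longleftrightarrow> (\<forall>q. q \<preceq> p \<longrightarrow> \<phi> q \<longrightarrow> \<psi> q)"
  proof (intro iffI allI impI)
    fix q assume *: "\<forall>q. q \<preceq> p \<longrightarrow> \<phi> q \<longrightarrow> (\<exists>r. r \<preceq> q \<and> \<psi> r)" "q \<preceq> p" "\<phi> q"
    show "\<psi> q"
    \<comment> \<open>The classical abbreviation yields \<psi> only densely below \<open>q\<close>;
      regularity of \<psi> brings it to \<open>q\<close> itself.\<close>
    proof (rule regular_dense[OF assms(2)])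
      show "q \<in> P" using *(2) by (rule below_in)
      show "\<exists>r. r \<preceq> s \<and> \<psi> r" if "s \<preceq> q" for s
        using *(1) below_trans[OF that *(2)] regular_mono[OF assms(1) *(3) that] by blast
    qed
  qed (blast dest: below_self)
  finally show ?thesis .
qed

lemma force_Iff:
  assumes "regular \<phi>" and "regular \<psi>"
  shows "(\<phi> \<^bold>\<longleftrightarrow> \<psi>) p \<longleftrightarrow> (\<forall>q. q \<preceq> p \<longrightarrow> \<phi> q \<longleftrightarrow> \<psi> q)"
  unfolding fIff_def force_And force_Imp[OF assms] force_Imp[OF assms(2,1)] by blast

text \<open>Different extensions of \<open>p\<close> may decide different witnesses, so
  \<open>p\<close> alone need not have one.\<close>

lemma force_Ex: "(\<^bold>\<exists>x. \<Phi> x) p \<longleftrightarrow> (\<forall>q. q \<preceq> p \<longrightarrow> (\<exists>r x. r \<preceq> q \<and> \<Phi> x r))"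
  unfolding fEx_def force_Not force_All by blast

lemma force_ExI:
  assumes "regular (\<Phi> x)" and "\<Phi> x p"
  shows "(\<^bold>\<exists>x. \<Phi> x) p"
  unfolding force_Ex using regular_mono[OF assms] below_self by blast

lemma force_ExE:
  assumes "(\<^bold>\<exists>x. \<Phi> x) p" and "q \<preceq> p"
  obtains r x where "r \<preceq> q" "\<Phi> x r"
  using assms unfolding force_Ex by blast

lemma force_Or:
  assumes "regular \<phi>" and "regular \<psi>"
  shows "(\<phi> \<^bold>\<or> \<psi>) p \<longleftrightarrow> (\<forall>q. q \<preceq> p \<longrightarrow> (\<exists>r. r \<preceq> q \<and> (\<phi> r \<or> \<psi> r)))"
proof -
  have "(\<phi> \<^bold>\<or> \<psi>) p \<longleftrightarrow>
      (\<forall>q. q \<preceq> p \<longrightarrow> \<not> ((\<forall>r. r \<preceq> q \<longrightarrow> \<not> \<phi> r) \<and> (\<forall>r. r \<preceq> q \<longrightarrow> \<not> \<psi> r)))"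
    by (simp add: fOr_def force_Not force_And)
  then show ?thesis by blast
qed

lemma force_OrI1: "regular \<phi> \<Longrightarrow> regular \<psi> \<Longrightarrow> \<phi> p \<Longrightarrow> (\<phi> \<^bold>\<or> \<psi>) p"
  and force_OrI2: "regular \<phi> \<Longrightarrow> regular \<psi> \<Longrightarrow> \<psi> p \<Longrightarrow> (\<phi> \<^bold>\<or> \<psi>) p"
  by (auto simp: force_Or dest: regular_mono below_self)

section \<open>Forced membership and functions\<close>

lemma regular_mem [simp]: "regular (a \<^bold>\<in> \<tau>)"
  by (rule regularI; unfold mem_def, fold below_def) (meson below_in below_refl below_trans)+

lemma mem_mono: "(a \<^bold>\<in> \<tau>) p \<Longrightarrow> q \<preceq> p \<Longrightarrow> (a \<^bold>\<in> \<tau>) q"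
  by (rule regular_mono[OF regular_mem])

lemma regular_mem2 [simp]: "regular (\<tau> \<^bold>\<in>\<^sub>2 C)"
  by (rule regularI; unfold mem2_def, fold below_def) (meson below_in below_refl below_trans)+

lemma regular_sub [simp]: "regular (\<tau> \<^bold>\<subseteq> \<upsilon>)"
  by (simp add: sub_def)

lemma regular_set_eq [simp]: "regular (\<tau> \<^bold>= \<upsilon>)"
  by (simp add: set_eq_def)

lemma regular_fun_name [simp]: "regular (fun_name f)"
  by (simp add: fun_name_def)

lemma fun_name_mono: "fun_name f p \<Longrightarrow> q \<preceq> p \<Longrightarrow> fun_name f q"
  by (rule regular_mono[OF regular_fun_name])

lemma force_sub: "(\<tau> \<^bold>\<subseteq> \<upsilon>) p \<longleftrightarrow> (\<forall>q a. q \<preceq> p \<longrightarrow> (a \<^bold>\<in> \<tau>) q \<longrightarrow> (a \<^bold>\<in> \<upsilon>) q)"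
  by (auto simp: sub_def force_All force_Imp)

lemma force_set_eq: "(\<tau> \<^bold>= \<upsilon>) p \<longleftrightarrow> (\<forall>q a. q \<preceq> p \<longrightarrow> (a \<^bold>\<in> \<tau>) q \<longleftrightarrow> (a \<^bold>\<in> \<upsilon>) q)"
  by (auto simp: set_eq_def force_All force_Iff)

lemma force_check [simp]: "p \<in> P \<Longrightarrow> (a \<^bold>\<in> check X) p \<longleftrightarrow> a \<in> X"
  unfolding mem_def check_def below_def[symmetric]
  by (simp, metis below_in(1) below_refl)

lemma force_section [simp]: "(b \<^bold>\<in> section_name R a) p \<longleftrightarrow> ((a, b) \<^bold>\<in> R) p"
  by (simp add: mem_def section_name_def)

lemma force_fun_name:
  "fun_name f p \<longleftrightarrow>
     (\<forall>q a. q \<preceq> p \<longrightarrow> (\<exists>r b. r \<preceq> q \<and> ((a, b) \<^bold>\<in> f) r)) \<and>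
     (\<forall>q a b c. q \<preceq> p \<longrightarrow> ((a, b) \<^bold>\<in> f) q \<longrightarrow> ((a, c) \<^bold>\<in> f) q \<longrightarrow> b = c)"
  by (auto simp: fun_name_def force_And force_All force_Ex force_Imp force_ground)

section \<open>Comprehension and choice in the extension\<close>

text \<open>Comprehension: this names the set that a family of regular sentences defines in the
  extension. All functions, unions and clubs of the extension used below are introduced in this
  way.\<close>

definition name_of :: "('a \<Rightarrow> 'p sentence) \<Rightarrow> ('a, 'p) name" where
  "name_of \<Phi> = {(a, q). q \<in> P \<and> \<Phi> a q}"

lemma force_name_of:
  assumes "regular (\<Phi> a)" and "p \<in> P"
  shows "(a \<^bold>\<in> name_of \<Phi>) p \<longleftrightarrow> \<Phi> a p"
proof
  assume "(a \<^bold>\<in> name_of \<Phi>) p"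
  then have "\<exists>r. r \<preceq> q \<and> \<Phi> a r" if "q \<preceq> p" for q
    using that assms(1) unfolding mem_def name_of_def below_def[symmetric]
    by (blast intro: regular_mono)
  with assms show "\<Phi> a p" by (rule regular_dense)
next
  assume "\<Phi> a p"
  with assms show "(a \<^bold>\<in> name_of \<Phi>) p"
    unfolding mem_def name_of_def below_def[symmetric] by (blast dest: below_self below_in regular_mono)
qed

text \<open>
  Choice in the extension without antichains: the least witness with respect to a ground model
  well-order of the candidates is decided densely often and is unique.
\<close>

definition least_witness :: "('x \<Rightarrow> 'p sentence) \<Rightarrow> 'x \<Rightarrow> 'p sentence" where
  "least_witness \<phi> x =
     (\<phi> x \<^bold>\<and> (\<^bold>\<forall>y. ground ((y, x) \<in> (SOME r. well_order_on UNIV r) - Id) \<^bold>\<longrightarrow> \<^bold>\<not> \<phi> y))"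

lemma regular_least_witness [simp]: "(\<And>x. regular (\<phi> x)) \<Longrightarrow> regular (least_witness \<phi> x)"
  by (simp add: least_witness_def)

lemma least_witness_sat: "least_witness \<phi> x p \<Longrightarrow> \<phi> x p"
  by (simp add: least_witness_def force_And)

lemma least_witness_unique:
  assumes reg: "\<And>x. regular (\<phi> x)"
    and p: "p \<in> P" and "least_witness \<phi> x p" "least_witness \<phi> y p"
  shows "x = y"
proof (rule ccontr)
  let ?w = "SOME r :: 'a rel. well_order_on UNIV r"
  assume "x \<noteq> y"
  moreover have "well_order_on UNIV ?w"
    using well_order_on by (rule someI_ex)
  ultimately have "(x, y) \<in> ?w - Id \<or> (y, x) \<in> ?w - Id"
    by (auto simp: well_order_on_def linear_order_on_def total_on_def)
  \<comment> \<open>The smaller of the two is forced to be a witness by its own clause, and forced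
    not to be one by the minimality of the other.\<close>
  then show False
    using assms
    by (auto simp: least_witness_def force_And force_All force_Imp force_Not force_ground)
      (meson below_refl)+
qed

lemma least_witness_exists:
  assumes reg: "\<And>x. regular (\<phi> x)" and ex: "(\<^bold>\<exists>x. \<phi> x) p"
  shows "(\<^bold>\<exists>x. least_witness \<phi> x) p"
  unfolding force_Ex
proof (intro allI impI)
  let ?w = "SOME r :: 'a rel. well_order_on UNIV r"
  fix q assume q: "q \<preceq> p"
  have "well_order_on UNIV ?w"
    using well_order_on by (rule someI_ex)
  then have wf: "wf (?w - Id)"
    by (simp add: well_order_on_def)
  obtain r x where "r \<preceq> q" "\<phi> x r"
    using ex q by (rule force_ExE)
  then have "x \<in> {x. \<exists>r. r \<preceq> q \<and> \<phi> x r}" by blast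
  \<comment> \<open>The minimum is taken over all candidates forced by some condition below
    \<open>q\<close>. A condition below \<open>s\<close> forcing a smaller candidate would also lie
    below \<open>q\<close>, so \<open>s\<close> forces \<open>z\<close> to be least.\<close>
  from wfE_min[OF wf this] obtain z where z: "z \<in> {x. \<exists>r. r \<preceq> q \<and> \<phi> x r}"
    and min: "\<And>y. (y, z) \<in> ?w - Id \<Longrightarrow> y \<notin> {x. \<exists>r. r \<preceq> q \<and> \<phi> x r}"
    by blast
  from z obtain s where s: "s \<preceq> q" "\<phi> z s" by blast
  have "least_witness \<phi> z s"
    unfolding least_witness_def
    using s reg min
    by (simp add: force_And force_All force_Imp force_Not force_ground) (meson below_trans)
  with s show "\<exists>r x. r \<preceq> q \<and> least_witness \<phi> x r" by blast
qed

lemma choice_function: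
  fixes \<phi> :: "'a \<Rightarrow> 'x \<Rightarrow> 'p sentence"
  assumes reg: "\<And>a x. regular (\<phi> a x)" and ex: "\<And>a. (\<^bold>\<exists>x. \<phi> a x) p"
  obtains f where "fun_name f p" "\<And>a x q. q \<in> P \<Longrightarrow> ((a, x) \<^bold>\<in> f) q \<Longrightarrow> \<phi> a x q"
proof
  let ?f = "name_of (\<lambda>(a, x). least_witness (\<phi> a) x)"
  have f: "((a, x) \<^bold>\<in> ?f) q \<longleftrightarrow> least_witness (\<phi> a) x q" if "q \<in> P" for a x q
    using that reg by (simp add: force_name_of)
  show "fun_name ?f p"
    unfolding force_fun_name
  proof (intro conjI allI impI)
    fix q a assume "q \<preceq> p"
    with least_witness_exists[OF reg ex[of a]]
    obtain r x where "r \<preceq> q" "least_witness (\<phi> a) x r" by (auto elim: force_ExE)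
    then show "\<exists>r b. r \<preceq> q \<and> ((a, b) \<^bold>\<in> ?f) r" using f by (meson below_in)
  next
    fix q a b c assume "q \<preceq> p" "((a, b) \<^bold>\<in> ?f) q" "((a, c) \<^bold>\<in> ?f) q"
    then show "b = c"
      using f least_witness_unique[of "\<phi> a"] reg by (meson below_in)
  qed
  show "\<phi> a x q" if "q \<in> P" "((a, x) \<^bold>\<in> ?f) q" for a x q
    using that f by (auto dest: least_witness_sat)
qed

text \<open>Comprehension one level higher. Distinct names may denote the same set and membership is
  up to forced equality, so the defining sentence has to respect that equality.\<close>

lemma force_mem2_name_of:
  assumes reg: "\<And>\<upsilon>. regular (\<Phi> \<upsilon>)"
    and cong: "\<And>\<tau> \<upsilon> q. q \<in> P \<Longrightarrow> (\<tau> \<^bold>= \<upsilon>) q \<Longrightarrow> \<Phi> \<upsilon> q \<Longrightarrow> \<Phi> \<tau> q"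
    and p: "p \<in> P"
  shows "(\<tau> \<^bold>\<in>\<^sub>2 name_of \<Phi>) p \<longleftrightarrow> \<Phi> \<tau> p"
proof
  assume mem: "(\<tau> \<^bold>\<in>\<^sub>2 name_of \<Phi>) p"
  show "\<Phi> \<tau> p"
  proof (rule regular_dense[OF reg p])
    fix q assume "q \<preceq> p"
    with mem obtain r s \<upsilon> where "r \<preceq> q" "\<Phi> \<upsilon> s" "r \<preceq> s" "(\<tau> \<^bold>= \<upsilon>) r"
      unfolding mem2_def name_of_def below_def[symmetric] by blast
    then show "\<exists>r. r \<preceq> q \<and> \<Phi> \<tau> r"
      using regular_mono[OF reg] cong below_in by blast
  qed
next
  assume "\<Phi> \<tau> p"
  moreover have "(\<tau> \<^bold>= \<tau>) q" for q
    by (simp add: force_set_eq)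
  ultimately show "(\<tau> \<^bold>\<in>\<^sub>2 name_of \<Phi>) p"
    unfolding mem2_def name_of_def below_def[symmetric]
    using p by simp (meson below_in below_refl)
qed

section \<open>Countability in the extension and covering by properness\<close>

text \<open>The countability clause of \<open>in_ctbl_subsets\<close> without its quantifier over
  \<open>f\<close>, so that \<open>choice_function\<close> can select enumerations.\<close>

definition enumerates :: "(nat \<times> 'a, 'p) name \<Rightarrow> ('a, 'p) name \<Rightarrow> 'p sentence" where
  "enumerates f \<tau> = (fun_name f \<^bold>\<and> (\<^bold>\<forall>x. x \<^bold>\<in> \<tau> \<^bold>\<longrightarrow> (\<^bold>\<exists>n. (n, x) \<^bold>\<in> f)))"

lemma regular_enumerates [simp]: "regular (enumerates f \<tau>)"
  by (simp add: enumerates_def)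

lemma force_enumerates:
  "enumerates f \<tau> p \<longleftrightarrow>
     fun_name f p \<and> (\<forall>q x. q \<preceq> p \<longrightarrow> (x \<^bold>\<in> \<tau>) q \<longrightarrow> (\<^bold>\<exists>n. (n, x) \<^bold>\<in> f) q)"
  by (auto simp: enumerates_def force_And force_All force_Imp)

abbreviation ctbl :: "('a, 'p) name \<Rightarrow> 'p sentence" where
  "ctbl \<tau> \<equiv> (\<^bold>\<exists>f. enumerates f \<tau>)"

lemma force_in_ctbl_subsets: "in_ctbl_subsets \<tau> UNIV p \<longleftrightarrow> ctbl \<tau> p"
  by (auto simp: in_ctbl_subsets_def enumerates_def force_And force_sub below_in)

lemma ctbl_subset:
  assumes "ctbl \<tau> p" and "(\<upsilon> \<^bold>\<subseteq> \<tau>) p"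
  shows "ctbl \<upsilon> p"
  using assms unfolding force_Ex[of "\<lambda>f. enumerates f _"] force_enumerates force_sub
  by (meson below_trans below_in)

text \<open>The usual argument carried out in the extension: choose an enumeration of each
  \<open>R(n)\<close>, then let the value of \<open>h\<close> at the code of \<open>(n, m)\<close>
  be the \<open>m\<close>-th entry of the \<open>n\<close>-th enumeration.\<close>

lemma ctbl_Union:
  fixes R :: "(nat \<times> 'a, 'p) name"
  assumes ctbl: "\<And>n. ctbl (section_name R n) p" and Un: "is_Union U R p"
  shows "ctbl U p"
proof -
  obtain g where g: "fun_name g p"
    and enum: "\<And>n f q. q \<in> P \<Longrightarrow> ((n, f) \<^bold>\<in> g) q \<Longrightarrow> enumerates f (section_name R n) q"
    using choice_function[of "\<lambda>n f. enumerates f (section_name R n)" p] ctbl by auto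
  define h where "h = name_of (\<lambda>(k, x).
    (\<^bold>\<exists>f. (fst (prod_decode k), f) \<^bold>\<in> g \<^bold>\<and> (snd (prod_decode k), x) \<^bold>\<in> f))"
  have h: "((k, x) \<^bold>\<in> h) q \<longleftrightarrow>
      (\<^bold>\<exists>f. (fst (prod_decode k), f) \<^bold>\<in> g \<^bold>\<and> (snd (prod_decode k), x) \<^bold>\<in> f) q" if "q \<in> P" for k x q
    using that by (simp add: h_def force_name_of)
  have hI: "((prod_encode (n, m), x) \<^bold>\<in> h) q"
    if "((n, f) \<^bold>\<in> g) q" "((m, x) \<^bold>\<in> f) q" "q \<in> P" for n m f x q
    using that h by (auto intro!: force_ExI[of _ f] simp: force_And)
  have gE: "\<exists>s f. s \<preceq> q \<and> ((n, f) \<^bold>\<in> g) s \<and> enumerates f (section_name R n) s" if "q \<preceq> p" for q n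
    using g that enum unfolding force_fun_name by (meson below_in)
  have "fun_name h p"
    unfolding force_fun_name
  proof (intro conjI allI impI)
    fix q k assume "q \<preceq> p"
    then obtain s f where s: "s \<preceq> q" "((fst (prod_decode k), f) \<^bold>\<in> g) s" "fun_name f s"
      using gE unfolding force_enumerates by blast
    then obtain t x where t: "t \<preceq> s" "((snd (prod_decode k), x) \<^bold>\<in> f) t"
      unfolding force_fun_name by (meson below_in below_refl)
    then have "((prod_encode (fst (prod_decode k), snd (prod_decode k)), x) \<^bold>\<in> h) t"
      using s by (meson hI below_in mem_mono)
    with s t show "\<exists>r b. r \<preceq> q \<and> ((k, b) \<^bold>\<in> h) r"
      by (auto intro: below_trans)
  next
    fix q k b c assume q: "q \<preceq> p" "((k, b) \<^bold>\<in> h) q" "((k, c) \<^bold>\<in> h) q"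
    then obtain r f where r: "r \<preceq> q" "((fst (prod_decode k), f) \<^bold>\<in> g) r"
        "((snd (prod_decode k), b) \<^bold>\<in> f) r"
      using h[of q] by (auto simp: force_Ex force_And below_in) (meson below_in below_refl)
    moreover from q r obtain s f' where s: "s \<preceq> r" "((fst (prod_decode k), f') \<^bold>\<in> g) s"
        "((snd (prod_decode k), c) \<^bold>\<in> f') s"
      using h[of q] by (auto simp: force_Ex force_And below_in)
    ultimately have fg: "((fst (prod_decode k), f) \<^bold>\<in> g) s" "((snd (prod_decode k), b) \<^bold>\<in> f) s"
      by (meson mem_mono)+
    \<comment> \<open>The values of \<open>g\<close> are names treated as ground model objects.
      Single-valuedness of \<open>g\<close> therefore makes \<open>f\<close> and \<open>f'\<close>
      literally the same name, and single-valuedness of that name finishes the comparison.\<close>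
    have "s \<preceq> p" using q r s by (meson below_trans)
    with g fg s have "f' = f"
      unfolding force_fun_name by blast
    moreover have "fun_name f s"
      using enum fg(1) s by (auto simp: force_enumerates below_in)
    ultimately show "b = c"
      using fg s unfolding force_fun_name by (meson below_in below_refl)
  qed
  moreover have "(\<^bold>\<exists>k. (k, x) \<^bold>\<in> h) q" if q: "q \<preceq> p" and x: "(x \<^bold>\<in> U) q" for q x
    unfolding force_Ex[of "\<lambda>k. (k, x) \<^bold>\<in> h"]
  proof (intro allI impI)
    fix q' assume q': "q' \<preceq> q"
    have "(\<^bold>\<exists>n. (n, x) \<^bold>\<in> R) q"
      using Un q x by (simp add: is_Union_def force_All force_Iff)
    then obtain r n where r: "r \<preceq> q'" "((n, x) \<^bold>\<in> R) r"
      using q' by (rule force_ExE)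
    moreover have "r \<preceq> p" using q q' r by (meson below_trans)
    ultimately obtain s f where s: "s \<preceq> r" "((n, f) \<^bold>\<in> g) s" "enumerates f (section_name R n) s"
      using gE by blast
    then have "(\<^bold>\<exists>m. (m, x) \<^bold>\<in> f) s"
      using r unfolding force_enumerates by (meson below_in below_refl force_section mem_mono)
    then obtain t m where "t \<preceq> s" "((m, x) \<^bold>\<in> f) t"
      using s by (meson below_in below_refl force_ExE)
    with r s show "\<exists>r k. r \<preceq> q' \<and> ((k, x) \<^bold>\<in> h) r"
      by (meson hI below_in below_trans mem_mono)
  qed
  ultimately have "enumerates h U p"
    by (simp add: force_enumerates)
  then show ?thesis
    by (intro force_ExI) simp_all
qed

text \<open>This yields cofinality of the club used for covering: a countable set of the extension
  stays countable when the image of the named function is added.\<close>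

lemma ctbl_Un_image:
  fixes \<tau> :: "('u, 'p) name" and f :: "(nat \<times> 'b, 'p) name" and \<iota> :: "'b \<Rightarrow> 'u"
  assumes \<tau>: "ctbl \<tau> p" and f: "fun_name f p" and inj: "inj \<iota>" and p: "p \<in> P"
  shows "ctbl (name_of (\<lambda>x. x \<^bold>\<in> \<tau> \<^bold>\<or> (\<^bold>\<exists>n b. ground (x = \<iota> b) \<^bold>\<and> (n, b) \<^bold>\<in> f))) p"
proof -
  define V where "V = name_of (\<lambda>x. \<^bold>\<exists>n b. ground (x = \<iota> b) \<^bold>\<and> (n, b) \<^bold>\<in> f)"
  define h where "h = name_of (\<lambda>(n, x). \<^bold>\<exists>b. ground (x = \<iota> b) \<^bold>\<and> (n, b) \<^bold>\<in> f)"
  have h: "((n, x) \<^bold>\<in> h) q \<longleftrightarrow> (\<^bold>\<exists>b. ground (x = \<iota> b) \<^bold>\<and> (n, b) \<^bold>\<in> f) q" if "q \<in> P" for n x q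
    using that by (simp add: h_def force_name_of)
  have "fun_name h p"
    unfolding force_fun_name
  proof (intro conjI allI impI)
    fix q n assume "q \<preceq> p"
    then obtain r b where "r \<preceq> q" "((n, b) \<^bold>\<in> f) r"
      using f unfolding force_fun_name by blast
    then have "((n, \<iota> b) \<^bold>\<in> h) r"
      by (auto simp: h below_in force_And force_ground intro!: force_ExI[of _ b])
    with \<open>r \<preceq> q\<close> show "\<exists>r b. r \<preceq> q \<and> ((n, b) \<^bold>\<in> h) r" by blast
  next
    fix q n x y assume q: "q \<preceq> p" "((n, x) \<^bold>\<in> h) q" "((n, y) \<^bold>\<in> h) q"
    then obtain r b where r: "r \<preceq> q" "x = \<iota> b" "((n, b) \<^bold>\<in> f) r"
      using h[of q] by (auto simp: force_Ex force_And force_ground below_in) (meson below_in below_refl)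
    from q r obtain s c where s: "s \<preceq> r" "y = \<iota> c" "((n, c) \<^bold>\<in> f) s"
      using h[of q] by (auto simp: force_Ex force_And force_ground below_in)
    have "((n, b) \<^bold>\<in> f) s" "s \<preceq> p"
      using q r s by (meson below_trans mem_mono)+
    with s f have "b = c"
      unfolding force_fun_name by blast
    with r s show "x = y" by simp
  qed
  moreover have "(\<^bold>\<exists>n. (n, x) \<^bold>\<in> h) q" if "q \<preceq> p" "(x \<^bold>\<in> V) q" for q x
  proof -
    have "(\<^bold>\<exists>n b. ground (x = \<iota> b) \<^bold>\<and> (n, b) \<^bold>\<in> f) q"
      using that by (simp add: V_def force_name_of below_in)
    then show ?thesis
      unfolding force_Ex[of "\<lambda>n. (n, x) \<^bold>\<in> h"]
      unfolding force_Ex[of "\<lambda>n. \<^bold>\<exists>b. ground (x = \<iota> b) \<^bold>\<and> (n, b) \<^bold>\<in> f"]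
      using h by (meson below_in)
  qed
  ultimately have "enumerates h V p"
    by (simp add: force_enumerates)
  then have V: "ctbl V p"
    by (intro force_ExI) simp_all
  \<comment> \<open>The sequence \<tau>, \<open>V\<close>, \<open>V\<close>, ... reduces the union
    of two sets to \<open>ctbl_Union\<close>.\<close>
  define R where "R = name_of (\<lambda>(n :: nat, x). x \<^bold>\<in> (if n = 0 then \<tau> else V))"
  have R: "((n, x) \<^bold>\<in> R) q \<longleftrightarrow> (x \<^bold>\<in> (if n = 0 then \<tau> else V)) q" if "q \<in> P" for n x q
    using that by (simp add: R_def force_name_of)
  have "ctbl (section_name R n) p" for n
    by (rule ctbl_subset[of "if n = 0 then \<tau> else V"])
      (use \<tau> V in \<open>auto simp: force_sub R below_in\<close>)
  moreover have "is_Union (name_of (\<lambda>x. \<^bold>\<exists>n. (n, x) \<^bold>\<in> R)) R p"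
    by (simp add: is_Union_def force_All force_Iff force_name_of below_in)
  ultimately have "ctbl (name_of (\<lambda>x. \<^bold>\<exists>n. (n, x) \<^bold>\<in> R)) p"
    by (rule ctbl_Union)
  then show ?thesis
  proof (rule ctbl_subset)
    show "(name_of (\<lambda>x. x \<^bold>\<in> \<tau> \<^bold>\<or> (\<^bold>\<exists>n b. ground (x = \<iota> b) \<^bold>\<and> (n, b) \<^bold>\<in> f)) \<^bold>\<subseteq> name_of (\<lambda>x. \<^bold>\<exists>n. (n, x) \<^bold>\<in> R)) p"
      unfolding force_sub
    proof (intro allI impI)
      fix q x
      assume q: "q \<preceq> p"
        and x: "(x \<^bold>\<in> name_of (\<lambda>x. x \<^bold>\<in> \<tau> \<^bold>\<or> (\<^bold>\<exists>n b. ground (x = \<iota> b) \<^bold>\<and> (n, b) \<^bold>\<in> f))) q"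
      have "\<exists>r. r \<preceq> q' \<and> (\<exists>n. ((n, x) \<^bold>\<in> R) r)" if q': "q' \<preceq> q" for q'
      proof -
        have "(x \<^bold>\<in> \<tau> \<^bold>\<or> (\<^bold>\<exists>n b. ground (x = \<iota> b) \<^bold>\<and> (n, b) \<^bold>\<in> f)) q"
          using x q by (simp add: force_name_of below_in)
        with q' obtain r where r: "r \<preceq> q'"
          "(x \<^bold>\<in> \<tau>) r \<or> (\<^bold>\<exists>n b. ground (x = \<iota> b) \<^bold>\<and> (n, b) \<^bold>\<in> f) r"
          by (auto simp: force_Or)
        then have "((0, x) \<^bold>\<in> R) r \<or> ((1, x) \<^bold>\<in> R) r"
          by (simp add: R V_def force_name_of below_in)
        with r show ?thesis by blast
      qed
      then have "(\<^bold>\<exists>n. (n, x) \<^bold>\<in> R) q"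
        by (auto simp: force_Ex)
      then show "(x \<^bold>\<in> name_of (\<lambda>x. \<^bold>\<exists>n. (n, x) \<^bold>\<in> R)) q"
        using q by (simp add: force_name_of below_in)
    qed
  qed
qed

text \<open>
  Applied to the club of all countable supersets of the image of the named function, preservation
  of the stationary set of all ground model countable sets yields the covering.
\<close>
lemma preserves_stationary_covering:
  fixes f :: "(nat \<times> 'b, 'p) name" and \<iota> :: "'b \<Rightarrow> 'u"
  assumes pres: "preserves_stationary (UNIV :: 'u set)" and inj: "inj \<iota>"
    and f: "fun_name f p" and p: "p \<in> P"
  obtains r X where "r \<preceq> p" "countable X" "\<And>n b q. q \<preceq> r \<Longrightarrow> ((n, b) \<^bold>\<in> f) q \<Longrightarrow> b \<in> X"
proof -
  define good :: "('u, 'p) name \<Rightarrow> 'p sentence"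
    where "good \<tau> = (ctbl \<tau> \<^bold>\<and> (\<^bold>\<forall>n b. (n, b) \<^bold>\<in> f \<^bold>\<longrightarrow> \<iota> b \<^bold>\<in> \<tau>))" for \<tau>
  have reg [simp]: "regular (good \<tau>)" for \<tau>
    by (simp add: good_def)
  have good: "good \<tau> q \<longleftrightarrow> ctbl \<tau> q \<and>
      (\<forall>r n b. r \<preceq> q \<longrightarrow> ((n, b) \<^bold>\<in> f) r \<longrightarrow> (\<iota> b \<^bold>\<in> \<tau>) r)" for \<tau> q
    by (auto simp: good_def force_And force_All force_Imp)
  have mem2: "(\<tau> \<^bold>\<in>\<^sub>2 name_of good) q \<longleftrightarrow> good \<tau> q" if "q \<in> P" for \<tau> q
  proof (rule force_mem2_name_of[OF reg _ that])
    fix \<tau> \<upsilon> q assume "(\<tau> \<^bold>= \<upsilon>) q" "good \<upsilon> q"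
    then show "good \<tau> q"
      using ctbl_subset[of \<upsilon> q \<tau>] by (auto simp: good force_set_eq force_sub)
  qed
  have ctbl_mono: "ctbl \<tau> q \<Longrightarrow> r \<preceq> q \<Longrightarrow> ctbl \<tau> r" for \<tau> :: "('u, 'p) name" and q r
    by (rule regular_mono[OF regular_Ex[OF regular_enumerates]])
  have reg_ctbl [simp]: "regular (in_ctbl_subsets \<tau> A)" for \<tau> :: "('u, 'p) name" and A
    by (simp add: in_ctbl_subsets_def)
  have "club_name UNIV (name_of good) p"
    unfolding club_name_def
  proof (intro force_And[THEN iffD2] conjI)
    show "(\<^bold>\<forall>\<tau>. \<tau> \<^bold>\<in>\<^sub>2 name_of good \<^bold>\<longrightarrow> in_ctbl_subsets \<tau> UNIV) p"
      by (auto simp: force_All force_Imp mem2 below_in good force_in_ctbl_subsets)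
    show "(\<^bold>\<forall>\<tau>. in_ctbl_subsets \<tau> UNIV \<^bold>\<longrightarrow> (\<^bold>\<exists>\<upsilon>. \<upsilon> \<^bold>\<in>\<^sub>2 name_of good \<^bold>\<and> \<tau> \<^bold>\<subseteq> \<upsilon>)) p"
      unfolding force_All
    proof
      fix \<tau> :: "('u, 'p) name"
      let ?\<upsilon> = "name_of (\<lambda>x. x \<^bold>\<in> \<tau> \<^bold>\<or> (\<^bold>\<exists>n b. ground (x = \<iota> b) \<^bold>\<and> (n, b) \<^bold>\<in> f))"
      have "(\<^bold>\<exists>\<upsilon>. \<upsilon> \<^bold>\<in>\<^sub>2 name_of good \<^bold>\<and> \<tau> \<^bold>\<subseteq> \<upsilon>) q" if q: "q \<preceq> p" and \<tau>: "ctbl \<tau> q" for q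
      proof (rule force_ExI[of _ ?\<upsilon>])
        have "good ?\<upsilon> q"
          unfolding good
        proof (intro conjI allI impI)
          show "ctbl ?\<upsilon> q"
            using ctbl_Un_image[OF \<tau> _ inj] f q by (meson below_in fun_name_mono)
          fix r n b assume r: "r \<preceq> q" and b: "((n, b) \<^bold>\<in> f) r"
          have "(\<^bold>\<exists>n b'. ground (\<iota> b = \<iota> b') \<^bold>\<and> (n, b') \<^bold>\<in> f) r"
            using b by (intro force_ExI[of _ n] force_ExI[of _ b]) (simp_all add: force_And force_ground)
          then show "(\<iota> b \<^bold>\<in> ?\<upsilon>) r"
            using r by (simp add: force_name_of below_in force_OrI2)
        qed
        moreover have "(\<tau> \<^bold>\<subseteq> ?\<upsilon>) q"
          by (simp add: force_sub force_name_of below_in force_OrI1)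
        ultimately show "(?\<upsilon> \<^bold>\<in>\<^sub>2 name_of good \<^bold>\<and> \<tau> \<^bold>\<subseteq> ?\<upsilon>) q"
          using q by (simp add: force_And mem2 below_in)
      qed simp
      then show "(in_ctbl_subsets \<tau> UNIV \<^bold>\<longrightarrow> (\<^bold>\<exists>\<upsilon>. \<upsilon> \<^bold>\<in>\<^sub>2 name_of good \<^bold>\<and> \<tau> \<^bold>\<subseteq> \<upsilon>)) p"
        by (simp add: force_Imp force_in_ctbl_subsets)
    qed
    have reg_Un: "regular (is_Union U g)" for U and g :: "(nat \<times> 'u, 'p) name"
      by (simp add: is_Union_def)
    have closed: "good U r" if q: "q \<preceq> p" and r: "r \<preceq> q" and Un: "is_Union U g r"
      and g: "\<And>n. good (section_name g n) q" for q r U and g :: "(nat \<times> 'u, 'p) name"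
      unfolding good
    proof (intro conjI allI impI)
      have "ctbl (section_name g n) q" for n
        using g by (simp add: good)
      then have "ctbl (section_name g n) r" for n
        using r by (rule ctbl_mono)
      then show "ctbl U r"
        using Un by (rule ctbl_Union)
      fix s n b assume s: "s \<preceq> r" and "((n, b) \<^bold>\<in> f) s"
      \<comment> \<open>Each member of the chain already contains the whole image, so its first
        member suffices.\<close>
      then have "((0, \<iota> b) \<^bold>\<in> g) s"
        using g[of 0] r by (auto simp: good intro: below_trans)
      then have "(\<^bold>\<exists>k. (k, \<iota> b) \<^bold>\<in> g) s"
        by (intro force_ExI[of _ 0]) simp_all
      then show "(\<iota> b \<^bold>\<in> U) s"
        using Un s by (simp add: is_Union_def force_All force_Iff)
    qed
    show "(\<^bold>\<forall>g :: (nat \<times> 'u, 'p) name.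
         (\<^bold>\<forall>n. section_name g n \<^bold>\<in>\<^sub>2 name_of good \<^bold>\<and> section_name g n \<^bold>\<subseteq> section_name g (Suc n)) \<^bold>\<longrightarrow>
         (\<^bold>\<forall>U. is_Union U g \<^bold>\<longrightarrow> U \<^bold>\<in>\<^sub>2 name_of good)) p"
      by (simp add: force_All force_Imp force_And mem2 below_in reg_Un) (blast intro: closed)
  qed
  moreover have "forced (remains_stationary UNIV (ctbl_subsets (UNIV :: 'u set)))"
  proof -
    \<comment> \<open>Every club is nonempty because it has a member above the empty set; this is
      all that stationarity of the full family requires.\<close>
    have "{} \<in> ctbl_subsets (UNIV :: 'u set)"
      by (simp add: ctbl_subsets_def)
    then have "stationary UNIV (ctbl_subsets (UNIV :: 'u set))"
      unfolding stationary_def club_def by blast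
    then show ?thesis
      using pres by (simp add: preserves_stationary_def)
  qed
  moreover have "regular (club_name UNIV C)" for C :: "(('u, 'p) name, 'p) name"
    by (simp add: club_name_def is_Union_def)
  ultimately have "(\<^bold>\<exists>X. ground (X \<in> ctbl_subsets UNIV) \<^bold>\<and> check X \<^bold>\<in>\<^sub>2 name_of good) p"
    using p by (simp add: forced_def remains_stationary_def force_All force_Imp)
  then obtain r X where r: "r \<preceq> p" and X: "X \<in> ctbl_subsets UNIV" "(check X \<^bold>\<in>\<^sub>2 name_of good) r"
    by (rule force_ExE[OF _ below_refl[OF p]]) (auto simp: force_And force_ground)
  show thesis
  proof
    show "r \<preceq> p" by (rule r)
    \<comment> \<open>The ground model set found in the club lives in the codomain of \<iota>;
      pulling it back along the injection keeps it countable.\<close>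
    show "countable (\<iota> -` X)"
      using X inj by (simp add: ctbl_subsets_def 
          countable_image_inj_Int_vimage[of \<iota> UNIV X, simplified])
    show "b \<in> \<iota> -` X" if "q \<preceq> r" "((n, b) \<^bold>\<in> f) q" for n b q
      using X that r by (auto simp: mem2 below_in good)
  qed
qed

text \<open>The \<open>nat\<close> summand supplies a copy of the power set of the naturals,
  whatever the type of conditions is, and Cantor's theorem applies.\<close>

lemma uncountable_set_set_set: "uncountable (UNIV :: ('p + nat) set set set)"
proof
  let ?j = "\<lambda>S. (\<lambda>n. {Inr n}) ` S :: ('p + nat) set set"
  assume "countable (UNIV :: ('p + nat) set set set)"
  then have "countable (range ?j)"
    by (rule countable_subset[rotated]) simp
  moreover have "inj ?j"
    by (rule injI) (simp add: inj_image_eq_iff inj_def)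
  ultimately have "countable (UNIV :: nat set set)"
    by (rule countable_image_inj_on)
  then have "range (from_nat_into (UNIV :: nat set set)) = Pow UNIV"
    by simp
  then show False
    using Cantors_theorem by blast
qed

text \<open>Properness speaks about one fixed type built from the conditions. Sets of pairs are
  moved into it by coding a pair as a natural number in the \<open>Inr\<close> summand and wrapping
  it in a singleton.\<close>

lemma proper_covering:
  fixes f :: "(nat \<times> (nat \<times> nat) set, 'p) name"
  assumes proper and f: "fun_name f p" and p: "p \<in> P"
  obtains r X where "r \<preceq> p" "countable X" "\<And>n b q. q \<preceq> r \<Longrightarrow> ((n, b) \<^bold>\<in> f) q \<Longrightarrow> b \<in> X"
proof -
  let ?j = "\<lambda>B. (\<lambda>x. {Inr (prod_encode x)}) ` B :: ('p + nat) set set"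
  have "inj (\<lambda>x. {Inr (prod_encode x)} :: ('p + nat) set)"
    by (simp add: inj_on_def)
  then have "inj ?j"
    by (intro injI) (simp add: inj_image_eq_iff)
  moreover have "preserves_stationary (UNIV :: ('p + nat) set set set)"
    using \<open>proper\<close> uncountable_set_set_set by (simp add: proper_def)
  ultimately show thesis
    using preserves_stationary_covering[OF _ _ f p] that by metis
qed

section \<open>A bound valid from 0 on\<close>

text \<open>Once \<open>m\<close> is decided, only the finitely many arguments below
  \<open>m\<close> escape the bound, and their values can be decided by finitely many further
  strengthenings.\<close>

lemma bounding_everywhere:
  fixes f :: "(nat \<times> nat, 'p) name"
  assumes omega_omega_bounding and f: "fun_name f p" and p: "p \<in> P"
  obtains r h where "r \<preceq> p" "\<And>n k q. q \<preceq> r \<Longrightarrow> ((n, k) \<^bold>\<in> f) q \<Longrightarrow> k \<le> h n"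
proof -
  have "(\<^bold>\<exists>h :: nat \<Rightarrow> nat. \<^bold>\<exists>m. \<^bold>\<forall>n k.
      ground (m \<le> n) \<^bold>\<and> (n, k) \<^bold>\<in> f \<^bold>\<longrightarrow> ground (k \<le> h n)) p"
    using assms by (simp add: omega_omega_bounding_def forced_def force_All force_Imp)
  then obtain r\<^sub>0 h\<^sub>0 where r\<^sub>0: "r\<^sub>0 \<preceq> p" and "(\<^bold>\<exists>m. \<^bold>\<forall>n k.
      ground (m \<le> n) \<^bold>\<and> (n, k) \<^bold>\<in> f \<^bold>\<longrightarrow> ground (k \<le> h\<^sub>0 n)) r\<^sub>0"
    by (rule force_ExE[OF _ below_refl[OF p]])
  note this(2)
  then obtain r\<^sub>1 m where "r\<^sub>1 \<preceq> r\<^sub>0" "(\<^bold>\<forall>n k.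
      ground (m \<le> n) \<^bold>\<and> (n, k) \<^bold>\<in> f \<^bold>\<longrightarrow> ground (k \<le> h\<^sub>0 n)) r\<^sub>1"
    by (rule force_ExE[OF _ below_self[OF r\<^sub>0]])
  note r\<^sub>1 = below_trans[OF this(1) r\<^sub>0] and h\<^sub>0 = this(2)
  have h\<^sub>0: "k \<le> h\<^sub>0 n" if "q \<preceq> r\<^sub>1" "m \<le> n" "((n, k) \<^bold>\<in> f) q" for n k q
    using h\<^sub>0 that by (auto simp: force_All force_Imp force_And force_ground)
  have "\<exists>r h. r \<preceq> r\<^sub>1 \<and> (\<forall>n<j. \<forall>k q. q \<preceq> r \<longrightarrow> ((n, k) \<^bold>\<in> f) q \<longrightarrow> k \<le> h n)" for j
  proof (induction j)
    case 0
    show ?case using below_self[OF r\<^sub>1] by auto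
  next
    case (Suc j)
    then obtain r h where r: "r \<preceq> r\<^sub>1"
      and h: "\<And>n k q. n < j \<Longrightarrow> q \<preceq> r \<Longrightarrow> ((n, k) \<^bold>\<in> f) q \<Longrightarrow> k \<le> h n"
      by blast
    have rp: "r \<preceq> p" using r r\<^sub>1 by (rule below_trans)
    then obtain s b where s: "s \<preceq> r" "((j, b) \<^bold>\<in> f) s"
      using f unfolding force_fun_name by blast
    \<comment> \<open>\<open>s\<close> has decided the value at \<open>j\<close> to be
      \<open>b\<close>, so \<open>b\<close> itself serves as the bound there.\<close>
    have "k \<le> (h(j := b)) n" if n: "n < Suc j" and q: "q \<preceq> s" and k: "((n, k) \<^bold>\<in> f) q" for n k q
    proof (cases "n = j")
      case True
      have "q \<preceq> p" using q s(1) rp by (meson below_trans)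
      moreover have "((j, b) \<^bold>\<in> f) q" using s(2) q by (rule mem_mono)
      ultimately have "k = b" using f k True unfolding force_fun_name by blast
      with True show ?thesis by simp
    next
      case False
      with n q k h[of n q k] below_trans[OF q s(1)] show ?thesis by simp
    qed
    with below_trans[OF s(1) r] show ?case
      by (intro exI[of _ s] exI[of _ "h(j := b)"]) blast
  qed
  from this[of m] obtain r h where r: "r \<preceq> r\<^sub>1"
    and h: "\<And>n k q. n < m \<Longrightarrow> q \<preceq> r \<Longrightarrow> ((n, k) \<^bold>\<in> f) q \<Longrightarrow> k \<le> h n"
    by blast
  show thesis
  proof
    show "r \<preceq> p" using r r\<^sub>1 by (rule below_trans)
    show "k \<le> (if n < m then h n else h\<^sub>0 n)" if "q \<preceq> r" "((n, k) \<^bold>\<in> f) q" for n k q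
      using that h h\<^sub>0[OF below_trans[OF \<open>q \<preceq> r\<close> r]] by simp
  qed
qed

section \<open>A ground model strategy below a named one\<close>

lemma filter_on_Inter:
  assumes "filter_on X D" and "\<And>k. k \<le> (n :: nat) \<Longrightarrow> E k \<in> D"
  shows "(\<Inter>k\<le>n. E k) \<in> D"
  using assms(2)
proof (induction n)
  case (Suc n)
  then have "E (Suc n) \<inter> (\<Inter>k\<le>n. E k) \<in> D"
    using assms(1) by (simp add: filter_on_def)
  then show ?case by (simp add: atMost_Suc)
qed simp

lemma regular_gen_filter [simp]: "regular (gen_filter X D \<tau>)"
  by (simp add: gen_filter_def)

lemma ground_strategy_below:
  assumes proper and omega_omega_bounding and D: "filter_on triangular_set D"
    and \<sigma>: "f_strategy_I (gen_filter triangular_set D) \<sigma> p" and p: "p \<in> P"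
  obtains r \<rho> where "r \<preceq> p" "strategy_I D \<rho>"
    "\<And>s x q. q \<preceq> r \<Longrightarrow> x \<in> \<rho> s \<Longrightarrow> ((s, x) \<^bold>\<in> \<sigma>) q"
proof -
  \<comment> \<open>Sequences of answers are coded by naturals because covering and bounding are
    stated for functions on \<open>nat\<close>.\<close>
  define \<phi> where "\<phi> n B = (ground (B \<in> D) \<^bold>\<and> check B \<^bold>\<subseteq> section_name \<sigma> (from_nat n))" for n B
  have "regular (\<phi> n B)" for n B
    by (simp add: \<phi>_def)
  moreover have "(\<^bold>\<exists>B. \<phi> n B) p" for n
    using \<sigma> by (simp add: \<phi>_def f_strategy_I_def gen_filter_def force_All force_And)
  ultimately obtain f where f: "fun_name f p"
    and f\<phi>: "\<And>n B q. q \<in> P \<Longrightarrow> ((n, B) \<^bold>\<in> f) q \<Longrightarrow> \<phi> n B q"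
    using choice_function[of \<phi> p] by blast
  obtain r X where r: "r \<preceq> p" "countable X"
    and X: "\<And>n B q. q \<preceq> r \<Longrightarrow> ((n, B) \<^bold>\<in> f) q \<Longrightarrow> B \<in> X"
    using proper_covering[OF \<open>proper\<close> f p] by blast
  \<comment> \<open>\<open>e\<close> sends \<open>n\<close> to the index in \<open>X\<close> of the
    set chosen at \<open>n\<close>.\<close>
  define e where "e = name_of (\<lambda>(n, k). \<^bold>\<exists>B. ground (k = to_nat_on X B) \<^bold>\<and> (n, B) \<^bold>\<in> f)"
  have e: "((n, k) \<^bold>\<in> e) q \<longleftrightarrow> (\<^bold>\<exists>B. ground (k = to_nat_on X B) \<^bold>\<and> (n, B) \<^bold>\<in> f) q" if "q \<in> P" for n k q
    using that by (simp add: e_def force_name_of)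
  have eI: "((n, to_nat_on X B) \<^bold>\<in> e) q" if "q \<in> P" "((n, B) \<^bold>\<in> f) q" for n B q
    using that by (auto simp: e force_And force_ground intro!: force_ExI[of _ B])
  have fr: "\<exists>s B. s \<preceq> q \<and> ((n, B) \<^bold>\<in> f) s" if "q \<preceq> r" for q n
    using f below_trans[OF that r(1)] unfolding force_fun_name by blast
  have "fun_name e r"
    unfolding force_fun_name
  proof (intro conjI allI impI)
    fix q n assume "q \<preceq> r"
    with fr obtain s B where "s \<preceq> q" "((n, B) \<^bold>\<in> f) s" by blast
    then show "\<exists>s k. s \<preceq> q \<and> ((n, k) \<^bold>\<in> e) s"
      using eI[OF below_in(1)[OF \<open>s \<preceq> q\<close>]] by blast
  next
    fix q n k l assume q: "q \<preceq> r" "((n, k) \<^bold>\<in> e) q" "((n, l) \<^bold>\<in> e) q"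
    have qP: "q \<in> P" using q(1) by (rule below_in)
    have k: "(\<^bold>\<exists>B. ground (k = to_nat_on X B) \<^bold>\<and> (n, B) \<^bold>\<in> f) q"
      and l: "(\<^bold>\<exists>B. ground (l = to_nat_on X B) \<^bold>\<and> (n, B) \<^bold>\<in> f) q"
      using q e[OF qP] by auto
    obtain s B where s: "s \<preceq> q" "k = to_nat_on X B" "((n, B) \<^bold>\<in> f) s"
      by (rule force_ExE[OF k below_refl[OF qP]]) (auto simp: force_And force_ground)
    obtain t C where t: "t \<preceq> s" "l = to_nat_on X C" "((n, C) \<^bold>\<in> f) t"
      by (rule force_ExE[OF l s(1)]) (auto simp: force_And force_ground)
    have "((n, B) \<^bold>\<in> f) t" using s(3) t(1) by (rule mem_mono)
    moreover have "t \<preceq> p" using t(1) s(1) q(1) r(1) by (meson below_trans)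
    ultimately have "B = C" using f t(3) unfolding force_fun_name by blast
    with s t show "k = l" by simp
  qed
  then obtain r' h where r': "r' \<preceq> r"
    and h: "\<And>n k q. q \<preceq> r' \<Longrightarrow> ((n, k) \<^bold>\<in> e) q \<Longrightarrow> k \<le> h n"
    using bounding_everywhere[OF \<open>omega_omega_bounding\<close>, of e r] below_in(1)[OF r(1)] by blast
  \<comment> \<open>An index up to the bound may belong to a set outside \<open>D\<close>, or to no
    element of \<open>X\<close> at all. The default \<open>triangular_set\<close> lies in
    \<open>D\<close> and keeps the intersection there.\<close>
  define E where "E k = (if from_nat_into X k \<in> D then from_nat_into X k else triangular_set)" for k
  define \<rho> where "\<rho> s = (\<Inter>k\<le>h (to_nat s). E k)" for s :: "answer list"
  show thesis
  proof
    show "r' \<preceq> p" using r' r(1) by (rule below_trans)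
    have "E k \<in> D" for k
      using D by (simp add: E_def filter_on_def)
    then show "strategy_I D \<rho>"
      unfolding strategy_I_def \<rho>_def using filter_on_Inter[OF D] by blast
    show "((s, x) \<^bold>\<in> \<sigma>) q" if q: "q \<preceq> r'" and x: "x \<in> \<rho> s" for s x q
    \<comment> \<open>The set chosen at \<open>s\<close> is decided only densely, but whichever it
      is, it occurs among the sets intersected in \<open>\<rho> s\<close>.\<close>
    proof (rule regular_dense[OF regular_mem])
      show "q \<in> P" using q by (rule below_in)
      fix q' assume q': "q' \<preceq> q"
      have "q' \<preceq> r'" using q' q by (rule below_trans)
      have "q' \<preceq> r" using \<open>q' \<preceq> r'\<close> r' by (rule below_trans)
      then obtain t B where t: "t \<preceq> q'" "((to_nat s, B) \<^bold>\<in> f) t"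
        using fr by blast
      have tP: "t \<in> P" using t(1) by (rule below_in)
      have "\<phi> (to_nat s) B t" using f\<phi> tP t(2) by blast
      then have B: "B \<in> D" "(check B \<^bold>\<subseteq> section_name \<sigma> s) t"
        by (auto simp: \<phi>_def force_And force_ground)
      have "B \<in> X" using X below_trans[OF t(1) \<open>q' \<preceq> r\<close>] t(2) by blast
      with r(2) B(1) have "E (to_nat_on X B) = B"
        by (simp add: E_def)
      moreover have "to_nat_on X B \<le> h (to_nat s)"
        using h[OF below_trans[OF t(1) \<open>q' \<preceq> r'\<close>]] eI[OF tP t(2)] by blast
      ultimately have "x \<in> B"
        using x by (auto simp: \<rho>_def)
      then have "((s, x) \<^bold>\<in> \<sigma>) t"
        using B(2) below_refl[OF tP] force_check[OF tP, of x B] force_section[of x \<sigma> s t]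
        unfolding force_sub by blast
      with t(1) show "\<exists>t. t \<preceq> q' \<and> ((s, x) \<^bold>\<in> \<sigma>) t" by blast
    qed
  qed
qed

section \<open>Ground model plays in the extension\<close>

lemma regular_f_restrict [simp]: "regular (f_restrict g n s)"
  by (simp add: f_restrict_def)

lemma regular_f_legal_answer [simp]: "regular (f_legal_answer n A m)"
  by (simp add: f_legal_answer_def)

lemma regular_f_play_against [simp]: "regular (f_play_against \<sigma> g)"
  by (simp add: f_play_against_def)

text \<open>The canonical name of \<open>g\<close> has its values decided by every condition, so its
  only initial segments are those of \<open>g\<close>. An answer contained in
  \<open>\<rho> s\<close> is contained in the larger move named by \<sigma>, and the other rules are
  absolute.\<close>

lemma force_ground_play:
  assumes play: "play_against \<rho> g" and p: "p \<in> P"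
    and \<rho>: "\<And>s x q. q \<preceq> p \<Longrightarrow> x \<in> \<rho> s \<Longrightarrow> ((s, x) \<^bold>\<in> \<sigma>) q"
  shows "f_play_against \<sigma> (check (range (\<lambda>n. (n, g n)))) p"
proof -
  let ?g = "check (range (\<lambda>n. (n, g n)))"
  have g: "((n, m) \<^bold>\<in> ?g) q \<longleftrightarrow> m = g n" if "q \<preceq> p" for n m q
    using below_in(1)[OF that] by auto
  have "fun_name ?g p"
    unfolding force_fun_name
  proof (intro conjI allI impI)
    fix q n assume "q \<preceq> p"
    then show "\<exists>r m. r \<preceq> q \<and> ((n, m) \<^bold>\<in> ?g) r"
      using below_self[of q p] g[of q n "g n"] by blast
  next
    fix q n m m' assume "q \<preceq> p" "((n, m) \<^bold>\<in> ?g) q" "((n, m') \<^bold>\<in> ?g) q"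
    then show "m = m'"
      using g[of q n m] g[of q n m'] by simp
  qed
  moreover have "f_legal_answer n (section_name \<sigma> s) m q"
    if q: "q \<preceq> p" and s: "f_restrict ?g n s q" and m: "((n, m) \<^bold>\<in> ?g) q" for n s m q
  proof -
    have "length s = n" and "\<And>k. k < n \<Longrightarrow> ((k, s ! k) \<^bold>\<in> ?g) q"
      using s below_self[OF q]
      by (simp_all add: f_restrict_def force_And force_All force_Imp force_ground del: force_check)
    then have "s = map g [0..<n]"
      using g[OF q] by (auto intro: nth_equalityI)
    moreover have "m = g n" using m g[OF q] by simp
    ultimately have legal: "legal_answer n (\<rho> s) m"
      using play by (simp add: play_against_def)
    have "(check (fset (snd m)) \<^bold>\<subseteq> section_name \<sigma> s) q"
      unfolding force_sub
    proof (intro allI impI)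
      fix t x assume t: "t \<preceq> q" and "(x \<^bold>\<in> check (fset (snd m))) t"
      then have "x \<in> \<rho> s"
        using legal below_in(1)[OF t] by (auto simp: legal_answer_def)
      with \<rho>[OF below_trans[OF t q]] show "(x \<^bold>\<in> section_name \<sigma> s) t"
        by simp
    qed
    with legal show ?thesis
      by (auto simp: f_legal_answer_def legal_answer_def force_And force_ground)
  qed
  ultimately show ?thesis
    by (simp add: f_play_against_def force_And force_All force_Imp)
qed

text \<open>The union of a ground model play that defeats \<rho> is a member of \<open>D\<close>,
  hence forced into the generated filter, while a winning \<sigma> would force it out.\<close>

lemma not_winning_strategy:
  assumes proper and omega_omega_bounding and D: "filter_on triangular_set D"
    and sR: "semi_Ramsey D" and p: "p \<in> P"
  shows "\<not> f_winning_strategy_I (gen_filter triangular_set D) \<sigma> p"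
proof
  let ?F = "gen_filter triangular_set D"
  assume win: "f_winning_strategy_I ?F \<sigma> p"
  then have "f_strategy_I ?F \<sigma> p"
    by (simp add: f_winning_strategy_I_def force_And)
  then obtain r \<rho> where r: "r \<preceq> p" and "strategy_I D \<rho>"
    and \<rho>: "\<And>s x q. q \<preceq> r \<Longrightarrow> x \<in> \<rho> s \<Longrightarrow> ((s, x) \<^bold>\<in> \<sigma>) q"
    using ground_strategy_below assms by blast
  with sR obtain g where g: "play_against \<rho> g" "(\<Union>n. fset (snd (g n))) \<in> D"
    by (auto simp: semi_Ramsey_def winning_strategy_I_def)
  let ?g = "check (range (\<lambda>n. (n, g n)))"
  let ?U = "\<Union>n. fset (snd (g n))"
  have rP: "r \<in> P" using r by (rule below_in)
  have "f_play_against \<sigma> ?g r"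
    using g(1) rP \<rho> by (rule force_ground_play)
  moreover have "(\<^bold>\<forall>x. x \<^bold>\<in> check ?U \<^bold>\<longleftrightarrow> (\<^bold>\<exists>n m. (n, m) \<^bold>\<in> ?g \<^bold>\<and> ground (x |\<in>| snd m))) r"
  proof -
    have "(\<^bold>\<exists>n m. (n, m) \<^bold>\<in> ?g \<^bold>\<and> ground (x |\<in>| snd m)) q \<longleftrightarrow> x \<in> ?U" if q: "q \<in> P" for q x
    proof
      assume ex: "(\<^bold>\<exists>n m. (n, m) \<^bold>\<in> ?g \<^bold>\<and> ground (x |\<in>| snd m)) q"
      obtain s n where s: "s \<preceq> q" "(\<^bold>\<exists>m. (n, m) \<^bold>\<in> ?g \<^bold>\<and> ground (x |\<in>| snd m)) s"
        using force_ExE[OF ex below_refl[OF q]] by blast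
      obtain t m where t: "t \<preceq> s" "((n, m) \<^bold>\<in> ?g \<^bold>\<and> ground (x |\<in>| snd m)) t"
        using force_ExE[OF s(2) below_self[OF s(1)]] by blast
      then show "x \<in> ?U"
        using below_in(1)[OF t(1)] by (auto simp: force_And force_ground)
    next
      assume "x \<in> ?U"
      then obtain n where "x |\<in>| snd (g n)" by auto
      then have "((n, g n) \<^bold>\<in> ?g \<^bold>\<and> ground (x |\<in>| snd (g n))) q"
        using q by (simp add: force_And force_ground)
      then show "(\<^bold>\<exists>n m. (n, m) \<^bold>\<in> ?g \<^bold>\<and> ground (x |\<in>| snd m)) q"
        by (intro force_ExI[of _ n] force_ExI[of _ "g n"]) simp_all
    qed
    then show ?thesis
      by (simp add: force_All force_Iff below_in)
  qed
  ultimately have "(\<^bold>\<not> ?F (check ?U)) r"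
    using win r below_self[OF r]
    by (simp add: f_winning_strategy_I_def force_And force_All force_Imp)
  moreover have "?F (check ?U) r"
  proof -
    have "(check ?U \<^bold>\<subseteq> check ?U) r"
      by (simp add: force_sub)
    then have "(\<^bold>\<exists>B. ground (B \<in> D) \<^bold>\<and> check B \<^bold>\<subseteq> check ?U) r"
      \<comment> \<open>The union is its own witness: it is a ground model member of
        \<open>D\<close> contained in itself.\<close>
      using g(2) by (intro force_ExI[of _ ?U]) (simp_all add: force_And force_ground)
    moreover have "?U \<subseteq> triangular_set"
      using D g(2) by (auto simp: filter_on_def)
    then have "(check ?U \<^bold>\<subseteq> check triangular_set) r"
      by (auto simp: force_sub below_in)
    ultimately show ?thesis
      by (simp add: gen_filter_def force_And)
  qed
  ultimately show False
    using below_refl[OF rP] by (auto simp: force_Not)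
qed

end

theorem theorem6p2p9:
  fixes P :: "'p set" and leq :: "'p rel" and D :: "(nat \<times> nat) set set"
  assumes "ultrafilter_on triangular_set D"
    and "semi_Ramsey D"
    and "forcing_notion P leq"
    and "forcing_notion.proper P leq"
    and "forcing_notion.omega_omega_bounding P leq"
    and "forcing_notion.forces_generates_ultrafilter P leq D"
  shows "forcing_notion.forces_generates_semi_Ramsey_ultrafilter P leq D"
proof -
  interpret forcing_notion P leq by fact
  have D: "filter_on triangular_set D"
    using assms(1) by (simp add: ultrafilter_on_def)
  \<comment> \<open>The ultrafilter half of the conclusion is the last assumption, so this half
    remains.\<close>
  have "f_semi_Ramsey (gen_filter triangular_set D) p" for p
    unfolding f_semi_Ramsey_def force_Not
  proof (intro allI impI notI)
    fix q assume q: "q \<preceq> p"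
      and ex: "(\<^bold>\<exists>\<sigma>. f_winning_strategy_I (gen_filter triangular_set D) \<sigma>) q"
    \<comment> \<open>Strengthening \<open>q\<close> fixes a single name for the supposed winning
      strategy.\<close>
    obtain r \<sigma> where "r \<preceq> q" "f_winning_strategy_I (gen_filter triangular_set D) \<sigma> r"
      using force_ExE[OF ex below_self[OF q]] by blast
    then show False
      using not_winning_strategy[OF assms(4,5) D assms(2) below_in(1)] by blast
  qed
  then show ?thesis
    using assms(6)
    by (simp add: forces_generates_semi_Ramsey_ultrafilter_def forces_generates_ultrafilter_def
        forced_def force_And)
qed

end
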